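(* Every $12$-representable graph belongs to $\mathcal{G}_2$.
   Context: For a word $w$, $\mathrm{alph}(w)$ is the set of letters occurring in $w$ and $|w|_a$ the number of occurrences of $a$; $w$ is $k$-uniform if $|w|_a=k$ for all $a\in\mathrm{alph}(w)$. For letters $a,b$, $\pi_{a,b}$ is the monoid morphism on words with $a\mapsto a$, $b\mapsto b$ and all other letters mapped to the empty word. For words $w,v$ with $\mathrm{alph}(w)=\mathrm{alph}(v)=A$, $G(w,v)$ is the undirected simple graph on vertex set $A$ in which distinct $a,b$ are adjacent iff $\pi_{a,b}(w)=\pi_{a,b}(v)$. For $k\in\mathbb{N}$, $\mathcal{G}_k$ is the set of graphs $G$ for which there exist $k$-uniform words $w,v\in V(G)^\ast$ with $G=G(w,v)$. For a word $w$ over $\mathbb{N}$, its reduction $\mathrm{red}(w)$ is obtained by replacing each occurrence of the $i$-th smallest letter of $w$ by $i$. A word $w$ over $\mathbb{N}$ has a $12$-match if it has a factor $f$ (contiguous subword) with $\mathrm{red}(f)=12$, i.e. two consecutive letters $x,y$ with $x<y$. A graph $G=(V,E)$ with $V\subseteq\mathbb{N}$ is $12$-representable if there exists a word $w$ over $\mathbb{N}$ with $\mathrm{alph}(w)=V$ such that for all distinct $i,j\in V$: $\{i,j\}\in E$ iff $\pi_{i,j}(w)$ has no $12$-match. *)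

theory Defs
  imports Main "HOL-Library.Sublist"
begin

text \<open>A graph is a pair of a vertex set and a set of unordered edges; words are lists and
  \<open>alph w\<close> is \<^term>\<open>set w\<close>.\<close>

type_synonym 'a graph = "'a set \<times> 'a set set"

definition simple_graph :: "'a graph \<Rightarrow> bool" where
  "simple_graph G \<longleftrightarrow> snd G \<subseteq> {{a, b} | a b. a \<in> fst G \<and> b \<in> fst G \<and> a \<noteq> b}"

definition uniform_word :: "nat \<Rightarrow> 'a list \<Rightarrow> bool" where
  "uniform_word k w \<longleftrightarrow> (\<forall>a \<in> set w. count_list w a = k)"

definition proj :: "'a \<Rightarrow> 'a \<Rightarrow> 'a list \<Rightarrow> 'a list" where
  "proj a b w = filter (\<lambda>c. c = a \<or> c = b) w"

text \<open>Only meaningful if \<^prop>\<open>set w = set v\<close>; this is required wherever it is used.\<close>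

definition word_graph :: "'a list \<Rightarrow> 'a list \<Rightarrow> 'a graph" where
  "word_graph w v =
    (set w, {{a, b} | a b. a \<in> set w \<and> b \<in> set w \<and> a \<noteq> b \<and> proj a b w = proj a b v})"

definition graph_class :: "nat \<Rightarrow> 'a graph set" where
  "graph_class k =
    {G. simple_graph G \<and>
        (\<exists>w v. w \<in> lists (fst G) \<and> v \<in> lists (fst G) \<and> uniform_word k w \<and> uniform_word k v \<and>
               set w = set v \<and> G = word_graph w v)}"

text \<open>The \<open>i\<close>-th smallest letter \<open>x\<close> of \<open>w\<close> (counting from 1) is the one with exactly \<open>i\<close>
  letters of \<open>w\<close> below or equal to it.\<close>

definition red :: "nat list \<Rightarrow> nat list" where
  "red w = map (\<lambda>x. card {y \<in> set w. y \<le> x}) w"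

definition has_12_match :: "nat list \<Rightarrow> bool" where
  "has_12_match w \<longleftrightarrow> (\<exists>f. sublist f w \<and> red f = [1, 2])"

definition representable_12 :: "nat graph \<Rightarrow> bool" where
  "representable_12 G \<longleftrightarrow>
    (\<exists>w. set w = fst G \<and>
         (\<forall>i \<in> fst G. \<forall>j \<in> fst G. i \<noteq> j \<longrightarrow>
            ({i, j} \<in> snd G \<longleftrightarrow> \<not> has_12_match (proj i j w))))"

end

theory Submission
  imports Defs "HOL-Library.Multiset"
begin

text \<open>
  A word has no 12-match iff it is weakly decreasing. Keep only the first and the last occurrence
  of every letter of a representing word, doubling the letters that occur once. The resulting
  2-uniform word \<open>u\<close> still has a decreasing projection to \<open>{i, j}\<close> exactly when the original word
  has one. Comparing \<open>u\<close> with its own decreasing rearrangement therefore yields the same graph.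
\<close>

lemma red_eq_12_iff: "red f = [1, 2] \<longleftrightarrow> (\<exists>x y. f = [x, y] \<and> x < y)"
proof
  assume r: "red f = [1, 2]"
  have "length f = length (red f)" by (simp add: red_def)
  with r have "length f = Suc (Suc 0)" by simp
  then obtain x y where f: "f = [x, y]"
    by (auto simp: length_Suc_conv)
  \<comment> \<open>If \<open>y \<le> x\<close>, both letters are counted at \<open>x\<close>, so
    its rank 1 forces \<open>x = y\<close>; but then the second rank would be 1 as well.\<close>
  have "x < y"
  proof (rule ccontr)
    assume "\<not> x < y"
    then have "{z \<in> {x, y}. z \<le> x} = {x, y}" by auto
    with r f have "card {x, y} = 1" by (simp add: red_def)
    then have "x = y" by (simp add: card_insert_if split: if_splits)
    with r f show False by (auto simp: red_def)
  qed
  with f show "\<exists>x y. f = [x, y] \<and> x < y" by blast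
next
  assume "\<exists>x y. f = [x, y] \<and> x < y"
  then obtain x y where f: "f = [x, y]" "x < y" by blast
  then have "{z \<in> {x, y}. z \<le> x} = {x}" "{z \<in> {x, y}. z \<le> y} = {x, y}" by auto
  with f show "red f = [1, 2]" by (simp add: red_def)
qed

text \<open>By transitivity only neighbours need comparing, and a two-letter factor of
  \<open>a # b # w'\<close> is either its prefix or a factor of \<open>b # w'\<close>.\<close>

lemma sorted_wrt_ge_iff_no_ascent:
  fixes w :: "'a::linorder list"
  shows "sorted_wrt (\<ge>) w \<longleftrightarrow> \<not> (\<exists>x y. sublist [x, y] w \<and> x < y)"
proof (induction w)
  case (Cons a w)
  show ?case
  proof (cases w)
    case w: (Cons b w')
    then have "(\<exists>x y. sublist [x, y] (a # w) \<and> x < y) \<longleftrightarrow>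
        a < b \<or> (\<exists>x y. sublist [x, y] w \<and> x < y)"
      by (auto simp: sublist_Cons_right)
    moreover have "sorted_wrt (\<ge>) (a # w) \<longleftrightarrow> a \<ge> b \<and> sorted_wrt (\<ge>) w"
      using w by auto
    ultimately show ?thesis using Cons.IH by (simp add: not_less)
  qed (auto simp: sublist_Cons_right)
qed simp

lemma has_12_match_iff: "has_12_match w \<longleftrightarrow> \<not> sorted_wrt (\<ge>) w"
  unfolding has_12_match_def red_eq_12_iff sorted_wrt_ge_iff_no_ascent by auto

text \<open>The set \<open>S\<close> holds the letters already seen to the left. A letter occurring once is
  emitted twice, since that occurrence is both first and last.\<close>

fun first_last :: "'a set \<Rightarrow> 'a list \<Rightarrow> 'a list" where
  "first_last S [] = []"
| "first_last S (x # xs) =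
    (if x \<in> S then [] else [x]) @ (if x \<in> set xs then [] else [x]) @ first_last (insert x S) xs"

lemma set_first_last [simp]: "set (first_last S w) = set w"
  by (induction w arbitrary: S) auto

text \<open>A letter in \<open>S\<close> has had its first occurrence already, so only its last one
  is still emitted.\<close>

lemma count_list_first_last:
  "count_list (first_last S w) a =
    (if a \<in> set w then if a \<in> S then 1 else 2 else 0)"
  by (induction w arbitrary: S) auto

lemma filter_first_last: "filter P (first_last S w) = first_last S (filter P w)"
proof (induction w arbitrary: S)
  case (Cons x xs)
  have "first_last (insert x S) (filter P xs) = first_last S (filter P xs)" if "\<not> P x"
  proof -
    \<comment> \<open>\<open>S\<close> is only ever tested against letters of the word, so a letter
      removed by the filter may be dropped from it.\<close>
    have "first_last (insert x S) ys = first_last S ys" if "x \<notin> set ys" for ys S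
      using that by (induction ys arbitrary: S) (auto simp: insert_commute[of _ x])
    with \<open>\<not> P x\<close> show ?thesis by simp
  qed
  with Cons show ?case by auto
qed simp

text \<open>A head outside \<open>S\<close> is emitted in front of every letter of the tail, hence
  bounds them all. A head in \<open>S\<close> may leave no trace in the output; the second
  assumption then supplies the bound.\<close>

lemma sorted_wrt_first_last_imp:
  fixes w :: "'a::linorder list"
  assumes "sorted_wrt (\<ge>) (first_last S w)" and "\<And>s y. s \<in> S \<Longrightarrow> y \<in> set w \<Longrightarrow> s \<ge> y"
  shows "sorted_wrt (\<ge>) w"
  using assms
proof (induction w arbitrary: S)
  case (Cons x xs)
  have x: "\<forall>y\<in>set xs. x \<ge> y"
    using Cons.prems by (cases "x \<in> S") (auto simp: sorted_wrt_append)
  have "sorted_wrt (\<ge>) (first_last (insert x S) xs)"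
    using Cons.prems(1) by (auto simp: sorted_wrt_append)
  then have "sorted_wrt (\<ge>) xs"
    by (rule Cons.IH) (use x Cons.prems(2) in auto)
  with x show ?case by simp
qed simp

lemma sorted_wrt_first_last_iff:
  fixes w :: "'a::linorder list"
  shows "sorted_wrt (\<ge>) (first_last {} w) \<longleftrightarrow> sorted_wrt (\<ge>) w"
proof
  have "sorted_wrt (\<ge>) (first_last S w)" if "sorted_wrt (\<ge>) w" for S
    using that by (induction w arbitrary: S) (auto simp: sorted_wrt_append)
  then show "sorted_wrt (\<ge>) w \<Longrightarrow> sorted_wrt (\<ge>) (first_last {} w)" .
qed (auto dest: sorted_wrt_first_last_imp)

lemma eq_rev_sort_iff: "w = rev (sort w) \<longleftrightarrow> sorted_wrt (\<ge>) w"
proof -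
  have "w = rev (sort w) \<longleftrightarrow> sort (rev w) = rev w"
    by (metis mset_rev mset_sort properties_for_sort rev_rev_ident sorted_sort)
  also have "\<dots> \<longleftrightarrow> sorted (rev w)"
    by (metis sorted_sort sorted_sort_id)
  also have "\<dots> \<longleftrightarrow> sorted_wrt (\<ge>) w"
    by (simp add: sorted_wrt_rev)
  finally show ?thesis .
qed

text \<open>This lets one word \<open>v\<close> serve all pairs: each projection of \<open>v\<close>
  is the decreasing rearrangement of that projection of \<open>u\<close>.\<close>

lemma proj_rev_sort: "proj a b (rev (sort w)) = rev (sort (proj a b w))"
  by (simp add: proj_def filter_sort flip: rev_filter)

theorem theorem8:
  fixes G :: "nat graph"
  assumes "simple_graph G" and "representable_12 G"
  shows "G \<in> graph_class 2"
proof -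
  obtain w where w: "set w = fst G"
    and edge: "\<And>i j. i \<in> fst G \<Longrightarrow> j \<in> fst G \<Longrightarrow> i \<noteq> j \<Longrightarrow>
      {i, j} \<in> snd G \<longleftrightarrow> \<not> has_12_match (proj i j w)"
    using assms(2) unfolding representable_12_def by blast
  define u where "u = first_last {} w"
  define v where "v = rev (sort u)"
  have set_u: "set u = fst G" and set_v: "set v = fst G"
    by (simp_all add: u_def v_def w)
  have count_u: "\<forall>a\<in>fst G. count_list u a = 2"
    by (simp add: u_def w count_list_first_last)
  \<comment> \<open>\<open>v\<close> is a permutation of \<open>u\<close>, so both have the same
    multiset of letters.\<close>
  moreover have "count_list v a = count_list u a" for a
    by (simp add: v_def flip: count_mset)
  ultimately have uniform: "uniform_word 2 u" "uniform_word 2 v"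
    by (simp_all add: uniform_word_def set_u set_v)
  have "proj i j u = proj i j v \<longleftrightarrow> \<not> has_12_match (proj i j w)" for i j
  proof -
    have "proj i j u = proj i j v \<longleftrightarrow> sorted_wrt (\<ge>) (proj i j u)"
      by (simp only: v_def proj_rev_sort eq_rev_sort_iff)
    also have "\<dots> \<longleftrightarrow> sorted_wrt (\<ge>) (proj i j w)"
      by (simp add: u_def proj_def filter_first_last sorted_wrt_first_last_iff)
    finally show ?thesis
      by (simp add: has_12_match_iff)
  qed
  with edge have adj: "{i, j} \<in> snd G \<longleftrightarrow> proj i j u = proj i j v"
    if "i \<in> fst G" "j \<in> fst G" "i \<noteq> j" for i j
    using that by simp
  have "snd G = {{i, j} | i j. i \<in> fst G \<and> j \<in> fst G \<and> i \<noteq> j \<and> proj i j u = proj i j v}"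
  proof (intro set_eqI iffI)
    fix e assume "e \<in> snd G"
    \<comment> \<open>Simplicity of \<open>G\<close> makes every edge a pair of distinct vertices,
      to which \<open>adj\<close> applies.\<close>
    moreover from this obtain i j where "e = {i, j}" "i \<in> fst G" "j \<in> fst G" "i \<noteq> j"
      using assms(1) unfolding simple_graph_def by blast
    ultimately show "e \<in> {{i, j} | i j. i \<in> fst G \<and> j \<in> fst G \<and> i \<noteq> j \<and> proj i j u = proj i j v}"
      using adj by blast
  qed (use adj in blast)
  then have "G = word_graph u v"
    by (simp add: prod_eq_iff word_graph_def set_u)
  with assms(1) uniform set_u set_v show ?thesis
    unfolding graph_class_def by blast
qed

end
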